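(* Let $R$ be a pseudoring. The following are equivalent: (a) $R$ is a pseudomeadow; (b) $R$ is reduced and $\mathrm{Spec}(R)=\mathrm{MaxSpec}(R)$.
   Context: A pseudoring is a commutative associative ring that is not required to have a multiplicative identity. A pseudoring $R$ is a pseudomeadow if every $x\in R$ has a von Neumann inverse, i.e. there is $x^{(-1)}\in R$ (necessarily unique) with $x\,x\,x^{(-1)}=x$ and $x\,x^{(-1)}x^{(-1)}=x^{(-1)}$. $R$ is reduced if it has no non-zero nilpotent elements. An ideal $\mathfrak{p}$ of $R$ is prime if $\mathfrak{p}\neq R$ and $xy\in\mathfrak{p}$ implies $x\in\mathfrak{p}$ or $y\in\mathfrak{p}$ for all $x,y\in R$. An ideal $\mathfrak{m}$ is maximal if $\mathfrak{m}\ne R$ and every ideal $I\supseteq\mathfrak{m}$ satisfies $I=\mathfrak{m}$ or $I=R$. $\mathrm{Spec}(R)$ is the set of all prime ideals of $R$ and $\mathrm{MaxSpec}(R)$ the set of all maximal ideals of $R$. (In a pseudoring, maximal ideals need not exist and need not be prime.) *)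

theory Defs
  imports Main
begin

text \<open>
  A pseudoring is a type of class \<^class>\<open>comm_ring\<close>: commutative and associative, with no unit
  required. This is why the ideal theory of \<open>HOL-Algebra\<close> and the power operation of
  \<^class>\<open>monoid_mult\<close> do not apply.
\<close>

definition vn_inverse :: "'a::comm_ring \<Rightarrow> 'a \<Rightarrow> bool" where
  "vn_inverse x y \<longleftrightarrow> x * x * y = x \<and> x * y * y = y"

definition pseudomeadow :: "'a::comm_ring itself \<Rightarrow> bool" where
  "pseudomeadow _ \<longleftrightarrow> (\<forall>x::'a. \<exists>y. vn_inverse x y)"

text \<open>
  Without a unit only powers with positive exponent exist; \<open>(((*) x) ^^ n) x\<close> is the power
  of \<open>x\<close> with exponent \<open>n + 1\<close>.
\<close>

definition nilpotent :: "'a::comm_ring \<Rightarrow> bool" where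
  "nilpotent x \<longleftrightarrow> (\<exists>n. (((*) x) ^^ n) x = 0)"

definition reduced :: "'a::comm_ring itself \<Rightarrow> bool" where
  "reduced _ \<longleftrightarrow> (\<forall>x::'a. nilpotent x \<longrightarrow> x = 0)"

text \<open>
  Closure under negation is stated separately, since without a unit it does not follow from
  closure under multiplication by ring elements.
\<close>

definition is_ideal :: "'a::comm_ring set \<Rightarrow> bool" where
  "is_ideal I \<longleftrightarrow>
     0 \<in> I \<and> (\<forall>x\<in>I. \<forall>y\<in>I. x + y \<in> I) \<and> (\<forall>x\<in>I. - x \<in> I) \<and> (\<forall>r. \<forall>x\<in>I. r * x \<in> I)"

definition is_prime_ideal :: "'a::comm_ring set \<Rightarrow> bool" where
  "is_prime_ideal P \<longleftrightarrow>
     is_ideal P \<and> P \<noteq> UNIV \<and> (\<forall>x y. x * y \<in> P \<longrightarrow> x \<in> P \<or> y \<in> P)"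

definition is_maximal_ideal :: "'a::comm_ring set \<Rightarrow> bool" where
  "is_maximal_ideal M \<longleftrightarrow>
     is_ideal M \<and> M \<noteq> UNIV \<and> (\<forall>I. is_ideal I \<longrightarrow> M \<subseteq> I \<longrightarrow> I = M \<or> I = UNIV)"

definition Spec :: "'a::comm_ring itself \<Rightarrow> 'a set set" where
  "Spec _ = {P. is_prime_ideal P}"

definition MaxSpec :: "'a::comm_ring itself \<Rightarrow> 'a set set" where
  "MaxSpec _ = {M. is_maximal_ideal M}"

end

theory Submission
  imports Defs
begin

text \<open>
  In a pseudomeadow, \<open>x x'\<close> with \<open>x'\<close> the inverse of \<open>x\<close> acts as a unit modulo any prime ideal
  avoiding \<open>x\<close>, so primes are maximal. If \<open>M\<close> is maximal, \<open>x y \<in> M\<close> and \<open>x \<notin> M\<close>, then the colon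
  ideal \<open>(M : y)\<close> is everything, hence \<open>y = y' y y \<in> M\<close>, so \<open>M\<close> is prime.

  Conversely, suppose that \<open>a\<close> is not a multiple of \<open>a\<^sup>2\<close> in a reduced pseudoring. The
  multiplicatively closed set of all \<open>a\<^sup>n - a\<^sup>n\<^sup>+\<^sup>1 r\<close> (formally \<open>a\<^sup>n (1 - a r)\<close>) with \<open>n \<ge> 1\<close> does
  not contain 0, since otherwise \<open>a - a\<^sup>2 r\<close> would be nilpotent, so some prime ideal \<open>P\<close> avoids it.
  If \<open>P\<close> were maximal, then \<open>P + a\<^sup>2R\<close>, which contains \<open>a\<^sup>3 \<notin> P\<close>, would be the whole pseudoring,
  and \<open>a - a\<^sup>2 r \<in> P\<close> for some \<open>r\<close>, a contradiction.
\<close>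

lemma is_ideal_diff:
  assumes "is_ideal I" "x \<in> I" "y \<in> I"
  shows "x - y \<in> I"
  using assms unfolding is_ideal_def by (metis diff_conv_add_uminus)

lemma is_ideal_mult_right:
  assumes "is_ideal I" "x \<in> I"
  shows "x * r \<in> I"
  using assms unfolding is_ideal_def by (metis mult.commute)

lemma is_ideal_colon:
  fixes t :: "'a::comm_ring"
  assumes "is_ideal I"
  shows "is_ideal {z. z * t \<in> I}"
  using assms unfolding is_ideal_def by (auto simp: distrib_right mult.assoc)

lemma subset_colon:
  assumes "is_ideal I"
  shows "I \<subseteq> {z. z * t \<in> I}"
  using assms is_ideal_mult_right by blast

text \<open>This is \<open>I + bR\<close>. In the absence of a unit it need not contain
  \<open>b\<close>, so it may be smaller than the ideal generated by \<open>I\<close> and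
  \<open>b\<close>.\<close>

lemma is_ideal_add_multiples:
  fixes b :: "'a::comm_ring"
  assumes "is_ideal I"
  shows "is_ideal {p + b * r | p r. p \<in> I}"
proof -
  let ?J = "{p + b * r | p r. p \<in> I}"
  have "0 \<in> ?J"
    using assms unfolding is_ideal_def by (intro CollectI exI[of _ 0]) auto
  moreover have "x + y \<in> ?J" if xy: "x \<in> ?J" "y \<in> ?J" for x y
  proof -
    obtain p r q s where "p \<in> I" "q \<in> I" "x = p + b * r" "y = q + b * s"
      using xy by blast
    moreover from this have "x + y = (p + q) + b * (r + s)"
      by (simp add: algebra_simps)
    ultimately show ?thesis
      using assms unfolding is_ideal_def by blast
  qed
  moreover have "- x \<in> ?J" if x: "x \<in> ?J" for x
  proof -
    obtain p r where "p \<in> I" "x = p + b * r"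
      using x by blast
    moreover from this have "- x = - p + b * (- r)"
      by simp
    ultimately show ?thesis
      using assms unfolding is_ideal_def by blast
  qed
  moreover have "s * x \<in> ?J" if x: "x \<in> ?J" for s x
  proof -
    obtain p r where "p \<in> I" "x = p + b * r"
      using x by blast
    moreover from this have "s * x = s * p + b * (s * r)"
      by (simp add: algebra_simps)
    ultimately show ?thesis
      using assms unfolding is_ideal_def by blast
  qed
  ultimately show ?thesis
    unfolding is_ideal_def by blast
qed

lemma subset_add_multiples:
  fixes b :: "'a::comm_ring"
  shows "I \<subseteq> {p + b * r | p r. p \<in> I}"
proof
  fix x assume "x \<in> I"
  moreover have "x = x + b * 0"
    by simp
  ultimately show "x \<in> {p + b * r | p r. p \<in> I}"
    by blast
qed

lemma is_ideal_Union_chain: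
  assumes "\<C> \<noteq> {}" "\<And>I. I \<in> \<C> \<Longrightarrow> is_ideal I"
    and chain: "\<And>I J. I \<in> \<C> \<Longrightarrow> J \<in> \<C> \<Longrightarrow> I \<subseteq> J \<or> J \<subseteq> I"
  shows "is_ideal (\<Union>\<C>)"
proof -
  have "x + y \<in> \<Union>\<C>" if xy: "x \<in> \<Union>\<C>" "y \<in> \<Union>\<C>" for x y
  proof -
    obtain I J where "I \<in> \<C>" "x \<in> I" "J \<in> \<C>" "y \<in> J"
      using xy by blast
    then obtain K where "K \<in> \<C>" "x \<in> K" "y \<in> K"
      using chain by blast
    then show ?thesis
      using assms(2) unfolding is_ideal_def by blast
  qed
  then show ?thesis
    using assms(1,2) unfolding is_ideal_def by blast
qed

text \<open>Zorn's lemma yields \<open>P\<close> maximal among the ideals disjoint from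
  \<open>S\<close>. If \<open>x * y \<in> P\<close> and \<open>x \<notin> P\<close>, then the colon
  ideal of \<open>y\<close> contains \<open>P\<close> and also \<open>x\<close>, so it meets
  \<open>S\<close>.\<close>

lemma exists_prime_ideal_disjoint:
  fixes S :: "'a::comm_ring set"
  assumes "S \<noteq> {}" "0 \<notin> S" and closed: "\<And>s t. s \<in> S \<Longrightarrow> t \<in> S \<Longrightarrow> s * t \<in> S"
  shows "\<exists>P. is_prime_ideal P \<and> P \<inter> S = {}"
proof -
  define \<A> where "\<A> = {I. is_ideal I \<and> I \<inter> S = {}}"
  have "{0} \<in> \<A>"
    using assms(2) unfolding \<A>_def is_ideal_def by auto
  moreover have "\<Union>\<C> \<in> \<A>" if "\<C> \<noteq> {}" "subset.chain \<A> \<C>" for \<C>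
    using that is_ideal_Union_chain[of \<C>] unfolding \<A>_def subset.chain_def by blast
  ultimately obtain P where P: "P \<in> \<A>" and max: "\<And>I. I \<in> \<A> \<Longrightarrow> P \<subseteq> I \<Longrightarrow> I = P"
    using subset_Zorn_nonempty[of \<A>] by blast
  then have ideal: "is_ideal P" and disj: "P \<inter> S = {}"
    unfolding \<A>_def by auto
  have colon: "\<exists>s\<in>S. s * y \<in> P" if "x * y \<in> P" "x \<notin> P" for x y
  proof -
    have "{z. z * y \<in> P} \<notin> \<A>"
      using max[OF _ subset_colon[OF ideal]] that by blast
    then show ?thesis
      using is_ideal_colon[OF ideal] unfolding \<A>_def by blast
  qed
  have "x \<in> P \<or> y \<in> P" if xy: "x * y \<in> P" for x y
  proof (rule ccontr)
    assume "\<not> (x \<in> P \<or> y \<in> P)"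
    then obtain s where "s \<in> S" "y * s \<in> P"
      using colon[OF xy] by (auto simp: mult.commute)
    \<comment> \<open>\<open>colon\<close> is used a second time, on the product
      \<open>y * s\<close> with \<open>y \<notin> P\<close>; this replaces \<open>y\<close> by an
      element of \<open>S\<close> as well.\<close>
    then obtain t where "t \<in> S" "t * s \<in> P"
      using colon \<open>\<not> (x \<in> P \<or> y \<in> P)\<close> by blast
    then show False
      using closed \<open>s \<in> S\<close> disj by blast
  qed
  moreover have "P \<noteq> UNIV"
    using assms(1) disj by blast
  ultimately show ?thesis
    using ideal disj unfolding is_prime_ideal_def by blast
qed

lemma funpow_mult_mult:
  fixes a x y :: "'a::comm_ring"
  shows "((*) a ^^ n) x * y = ((*) a ^^ n) (x * y)"
  by (induction n) (simp_all add: mult.assoc)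

text \<open>Formally \<open>(a - a r)^n z = (1 - r)^n a^n z\<close>. The induction absorbs one
  factor into \<open>z\<close> at a time: if \<open>a^n\<close> kills \<open>a * z\<close>, it also
  kills \<open>(a - a * r) * z\<close>.\<close>

lemma funpow_mult_eq_0_diff_multiple:
  fixes a r z :: "'a::comm_ring"
  assumes "((*) a ^^ n) z = 0"
  shows "((*) (a - a * r) ^^ n) z = 0"
proof -
  have diff: "((*) a ^^ n) (x - y) = ((*) a ^^ n) x - ((*) a ^^ n) y" for n and x y :: 'a
    by (induction n) (simp_all add: right_diff_distrib)
  show ?thesis
    using assms
  proof (induction n arbitrary: z)
    case (Suc n)
    then have 0: "((*) a ^^ n) (a * z) = 0"
      by (simp add: funpow_Suc_right del: funpow.simps)
    have "(a - a * r) * z = a * z - a * z * r"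
      by (simp add: algebra_simps)
    then have "((*) a ^^ n) ((a - a * r) * z) = 0"
      using 0 by (simp add: diff flip: funpow_mult_mult)
    then show ?case
      using Suc.IH[of "(a - a * r) * z"] by (simp add: funpow_Suc_right del: funpow.simps)
  qed simp
qed

text \<open>Since \<open>x * y\<close> acts as a unit on \<open>x\<close>, the extra factor
  \<open>x * y\<close> preserves the first equation. Multiplying the new first equation by
  \<open>y * y\<close> gives the second.\<close>

lemma vn_inverse_if_square_dvd:
  fixes x y :: "'a::comm_ring"
  assumes "x = x * x * y"
  shows "vn_inverse x (x * y * y)"
proof -
  have "x * x * (x * y * y) = (x * x * y) * x * y"
    by (simp add: ac_simps)
  then have 1: "x * x * (x * y * y) = x"
    using assms by simp
  have "x * (x * y * y) * (x * y * y) = (x * x * (x * y * y)) * y * y"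
    by (simp add: ac_simps)
  then show ?thesis
    using 1 unfolding vn_inverse_def by simp
qed

lemma reduced_if_pseudomeadow:
  assumes "pseudomeadow TYPE('a::comm_ring)"
  shows "reduced TYPE('a)"
proof -
  have "x = 0" if nil: "((*) x ^^ n) x = 0" for x :: 'a and n
  proof -
    obtain y where "x * x * y = x"
      using assms unfolding pseudomeadow_def vn_inverse_def by blast
    \<comment> \<open>Multiplication by \<open>y\<close> lowers the exponent by one, so the
      vanishing of a power descends to \<open>x\<close> itself.\<close>
    then have "((*) x ^^ Suc n) x * y = ((*) x ^^ n) x" for n
      by (simp add: funpow_mult_mult funpow_Suc_right del: funpow.simps)
    then have "((*) x ^^ Suc n) x = 0 \<Longrightarrow> ((*) x ^^ n) x = 0" for n
      by (metis mult_zero_left)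
    then show ?thesis
      using nil by (induction n) (simp, blast)
  qed
  then show ?thesis
    unfolding reduced_def nilpotent_def by blast
qed

lemma prime_iff_maximal_if_pseudomeadow:
  fixes P :: "'a::comm_ring set"
  assumes "pseudomeadow TYPE('a)"
  shows "is_prime_ideal P \<longleftrightarrow> is_maximal_ideal P"
proof
  assume prime: "is_prime_ideal P"
  have "I = UNIV" if I: "is_ideal I" "P \<subseteq> I" "I \<noteq> P" for I
  proof -
    obtain x where x: "x \<in> I" "x \<notin> P"
      using I by blast
    obtain y where y: "x * x * y = x"
      using assms unfolding pseudomeadow_def vn_inverse_def by blast
    have "r \<in> I" for r
    proof -
      \<comment> \<open>The right-hand side is 0 by the choice of \<open>y\<close>.\<close>
      have "x * (x * y * r - r) = (x * x * y) * r - x * r"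
        by (simp add: algebra_simps)
      then have "x * (x * y * r - r) \<in> P"
        using y prime unfolding is_prime_ideal_def is_ideal_def by simp
      then have "x * y * r - r \<in> I"
        using x prime I(2) unfolding is_prime_ideal_def by blast
      moreover have "x * y * r \<in> I"
        using is_ideal_mult_right I(1) x(1) by blast
      ultimately show ?thesis
        using is_ideal_diff[OF I(1), of "x * y * r" "x * y * r - r"] by simp
    qed
    then show ?thesis
      by blast
  qed
  then show "is_maximal_ideal P"
    using prime unfolding is_maximal_ideal_def is_prime_ideal_def by blast
next
  assume max: "is_maximal_ideal P"
  then have ideal: "is_ideal P"
    unfolding is_maximal_ideal_def by blast
  have "y \<in> P" if "x * y \<in> P" "x \<notin> P" for x y
  proof -
    have "{z. z * y \<in> P} = UNIV"
      using max is_ideal_colon[OF ideal, of y] subset_colon[OF ideal, of y] that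
      unfolding is_maximal_ideal_def by blast
    then have "z * y \<in> P" for z
      by blast
    moreover obtain y' where "y * y * y' = y"
      using assms unfolding pseudomeadow_def vn_inverse_def by blast
    ultimately show ?thesis
      using is_ideal_mult_right[OF ideal] by metis
  qed
  then show "is_prime_ideal P"
    using max unfolding is_maximal_ideal_def is_prime_ideal_def by blast
qed

lemma pseudomeadow_if_prime_imp_maximal:
  assumes red: "reduced TYPE('a::comm_ring)"
    and max: "\<And>P :: 'a set. is_prime_ideal P \<Longrightarrow> is_maximal_ideal P"
  shows "pseudomeadow TYPE('a)"
proof -
  have "\<exists>r. a = a * a * r" for a :: 'a
  proof (rule ccontr)
    assume not: "\<not> (\<exists>r. a = a * a * r)"
    define S where "S = {((*) a ^^ n) (a - a * a * r) | n r. True}"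
    have in_S: "((*) a ^^ n) (a - a * a * r) \<in> S" for n r
      unfolding S_def by blast
    have pow_in_S: "((*) a ^^ n) a \<in> S" for n
      using in_S[of n 0] by simp
    have "0 \<notin> S"
    proof
      assume "0 \<in> S"
      then obtain n r where "((*) a ^^ n) (a - a * a * r) = 0"
        unfolding S_def by auto
      \<comment> \<open>The \<open>n\<close> factors \<open>a\<close> are traded for
        \<open>a - a * (a * r)\<close>, which exhibits \<open>a - a * a * r\<close> as
        nilpotent.\<close>
      then have "((*) (a - a * a * r) ^^ n) (a - a * a * r) = 0"
        using funpow_mult_eq_0_diff_multiple[of n a _ "a * r"] by (simp add: mult.assoc)
      then show False
        using red not unfolding reduced_def nilpotent_def by (metis eq_iff_diff_eq_0)
    qed
    moreover have "s * t \<in> S" if st: "s \<in> S" "t \<in> S" for s t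
    proof -
      obtain n m q r where s: "s = ((*) a ^^ n) (a - a * a * q)" and t: "t = ((*) a ^^ m) (a - a * a * r)"
        using st unfolding S_def by blast
      have "s * t = ((*) a ^^ n) (((*) a ^^ m) ((a - a * a * r) * (a - a * a * q)))"
        unfolding s t by (metis funpow_mult_mult mult.commute)
      \<comment> \<open>Formally \<open>(1 - a r) (1 - a q) = 1 - a (q + r - a q r)\<close>,
        multiplied by \<open>a * a\<close>.\<close>
      also have "(a - a * a * r) * (a - a * a * q) = a * (a - a * a * (q + r - a * q * r))"
        by (simp add: algebra_simps)
      also have "((*) a ^^ n) (((*) a ^^ m) \<dots>) = ((*) a ^^ (n + Suc m)) (a - a * a * (q + r - a * q * r))"
        by (simp add: funpow_add funpow_Suc_right del: funpow.simps)
      finally show ?thesis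
        using in_S by (simp only:)
    qed
    moreover have "S \<noteq> {}"
      using in_S by blast
    ultimately obtain P where P: "is_prime_ideal P" "P \<inter> S = {}"
      using exists_prime_ideal_disjoint by metis
    then have ideal: "is_ideal P"
      unfolding is_prime_ideal_def by blast
    let ?J = "{p + a * a * r | p r. p \<in> P}"
    \<comment> \<open>The cube is the witness because \<open>a * a\<close> itself need not be a
      multiple of \<open>a * a\<close>.\<close>
    have "0 + a * a * a \<in> ?J"
      using ideal unfolding is_ideal_def by blast
    moreover have "a * a * a \<notin> P"
      using pow_in_S[of 2] P(2) by (auto simp: numeral_2_eq_2 mult.assoc)
    ultimately have "?J \<noteq> P"
      by auto
    then have "?J = UNIV"
      using max[OF P(1)] is_ideal_add_multiples[OF ideal, of "a * a"] subset_add_multiples[of P "a * a"]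
      unfolding is_maximal_ideal_def by blast
    then obtain p r where "p \<in> P" "a = p + a * a * r"
      by blast
    then have "a - a * a * r \<in> P"
      by (metis add_diff_cancel_right')
    then show False
      using in_S[of 0 r] P(2) by auto
  qed
  then show ?thesis
    unfolding pseudomeadow_def using vn_inverse_if_square_dvd by blast
qed

theorem theorem4p6:
  shows "pseudomeadow TYPE('a::comm_ring) \<longleftrightarrow>
           reduced TYPE('a) \<and> Spec TYPE('a) = MaxSpec TYPE('a)"
  using reduced_if_pseudomeadow prime_iff_maximal_if_pseudomeadow pseudomeadow_if_prime_imp_maximal
  unfolding Spec_def MaxSpec_def by blast

end
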